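(* Let $\mathcal{F} = \{f_i\}_{i \in I}$ be a Bessel sequence in $H$, and suppose $\inf_{i \in I} \|f_i\| > 0$. Assume $\mathcal{E} = \{e_j\}_{j \in G}$ is a frame for $H$, and let $a \colon I \to G$ be a map. If $(\mathcal{F},a,\mathcal{E})$ has $\ell^2$-row decay, then $D^+(I,a) < \infty$.
   Context: $H$ is a separable Hilbert space and $I$ is a countable index set. $G = \prod_{i=1}^d a_i \mathbf{Z} \times \prod_{j=1}^e \mathbf{Z}_{n_j}$ (with $d \ge 1$, $a_i>0$, a countably infinite abelian group), equipped with $|g| = \sup\{|a_1 k_1|,\dots,|a_d k_d|,\delta(m_1),\dots,\delta(m_e)\}$ for $g=(a_1k_1,\dots,a_dk_d,m_1,\dots,m_e)$, where $\delta(0)=0$ and $\delta(m)=1$ for $m\neq 0$. For $N \in \mathbf{N}$ and $j\in G$ put $S_N(j) = \{k \in G : |k-j| \le N/2\}$ and $I_N(j) = a^{-1}(S_N(j))$. The upper density is $D^+(I,a) = \limsup_{N\to\infty} \sup_{j\in G} |I_N(j)|/|S_N(j)| \in [0,\infty]$. A frame for $H$ is a sequence $\{g_i\}$ with constants $A,B>0$ such that $A\|f\|^2 \le \sum_i |\langle f,g_i\rangle|^2 \le B\|f\|^2$ for all $f\in H$; a Bessel sequence is one satisfying the upper inequality for some $B$. $(\mathcal{F},a,\mathcal{E})$ has $\ell^2$-row decay if for every $\varepsilon>0$ there is an integer $N_\varepsilon>0$ such that for all $i\in I$, $\sum_{j\in G\setminus S_{N_\varepsilon}(a(i))} |\langle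 f_i,e_j\rangle|^2<\varepsilon$. *)

theory Defs
  imports "HOL-Analysis.Analysis" "HOL-Algebra.Product_Groups"
begin

section \<open>Hilbert spaces over the real or the complex numbers\<close>

text \<open>
  A normed field over the reals has a multiplicative norm here, so it is a copy of the real or of
  the complex numbers; the last axiom then forces \<open>conjugation\<close> to be the identity, respectively
  complex conjugation. This lets Hilbert spaces be treated over both scalar fields at once.
\<close>
class hilbert_scalar = real_normed_field +
  fixes conjugation :: "'a \<Rightarrow> 'a"
  assumes conjugation_add: "conjugation (a + b) = conjugation a + conjugation b"
    and conjugation_mult: "conjugation (a * b) = conjugation a * conjugation b"
    and conjugation_conjugation: "conjugation (conjugation a) = a"
    and conjugation_mult_self: "conjugation a * a = (norm a)\<^sup>2 *\<^sub>R 1"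

instantiation real :: hilbert_scalar
begin
definition conjugation_real :: "real \<Rightarrow> real" where "conjugation_real a = a"
instance by standard (simp_all add: conjugation_real_def power2_eq_square)
end

instantiation complex :: hilbert_scalar
begin
definition conjugation_complex :: "complex \<Rightarrow> complex" where "conjugation_complex a = cnj a"
instance
proof
  fix a :: complex
  show "conjugation a * a = (norm a)\<^sup>2 *\<^sub>R 1"
    using complex_norm_square[of a]
    by (simp add: conjugation_complex_def scaleR_conv_of_real mult.commute)
qed (simp_all add: conjugation_complex_def)
end

text \<open>
  Completeness is part of the class \<open>banach\<close>. The axiom \<open>ip_self\<close> says that the norm is the one
  induced by the inner product; positive definiteness of the inner product is a consequence.
\<close>
locale hilbert_space = vector_space scl
  for scl :: "'k::hilbert_scalar \<Rightarrow> 'h::banach \<Rightarrow> 'h" +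
  fixes ip :: "'h \<Rightarrow> 'h \<Rightarrow> 'k"
  assumes scl_of_real: "scl (of_real r) x = r *\<^sub>R x"
    and ip_add_left: "ip (x + y) z = ip x z + ip y z"
    and ip_scl_left: "ip (scl c x) y = c * ip x y"
    and ip_commute: "ip y x = conjugation (ip x y)"
    and ip_self: "ip x x = of_real ((norm x)\<^sup>2)"

lemma hilbert_space_real: "hilbert_space (*\<^sub>R) (inner :: 'h::{banach, real_inner} \<Rightarrow> 'h \<Rightarrow> real)"
  by unfold_locales
    (simp_all add: scaleR_right_distrib scaleR_left_distrib inner_left_distrib
      conjugation_real_def power2_norm_eq_inner, rule inner_commute)

lemma hilbert_space_complex: "hilbert_space (*) (\<lambda>x y. x * cnj y)"
proof unfold_locales
  fix x :: complex
  show "x * cnj x = of_real ((norm x)\<^sup>2)"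
    using complex_norm_square[of x] by simp
qed (simp_all add: algebra_simps scaleR_conv_of_real conjugation_complex_def)


section \<open>Bessel sequences and frames\<close>

text \<open>
  Infinite sums are taken in \<open>ennreal\<close>, where they always exist; a real-valued \<open>infsum\<close> would be 0
  for a divergent series.
\<close>
definition bessel_sequence :: "('h::real_normed_vector \<Rightarrow> 'h \<Rightarrow> 'k::real_normed_field) \<Rightarrow>
    'i set \<Rightarrow> ('i \<Rightarrow> 'h) \<Rightarrow> bool" where
  "bessel_sequence ip I g \<longleftrightarrow>
    (\<exists>B>0. \<forall>x. (\<Sum>\<^sub>\<infinity>i\<in>I. ennreal ((norm (ip x (g i)))\<^sup>2)) \<le> ennreal (B * (norm x)\<^sup>2))"

definition frame :: "('h::real_normed_vector \<Rightarrow> 'h \<Rightarrow> 'k::real_normed_field) \<Rightarrow>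
    'i set \<Rightarrow> ('i \<Rightarrow> 'h) \<Rightarrow> bool" where
  "frame ip I g \<longleftrightarrow>
    (\<exists>A>0. \<exists>B>0. \<forall>x.
      ennreal (A * (norm x)\<^sup>2) \<le> (\<Sum>\<^sub>\<infinity>i\<in>I. ennreal ((norm (ip x (g i)))\<^sup>2)) \<and>
      (\<Sum>\<^sub>\<infinity>i\<in>I. ennreal ((norm (ip x (g i)))\<^sup>2)) \<le> ennreal (B * (norm x)\<^sup>2))"


section \<open>The index group\<close>

definition real_multiples :: "real \<Rightarrow> real monoid" where
  "real_multiples c = \<lparr>carrier = range (\<lambda>k::int. c * of_int k), monoid.mult = (+), one = 0\<rparr>"

type_synonym index = "(nat \<Rightarrow> real) \<times> (nat \<Rightarrow> int)"

text \<open>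
  The numbers \<open>c i\<close> are the generators of the infinite cyclic factors (the letter \<open>a\<close> is kept for
  the map into the group). Coordinates are numbered from 0, and the residues modulo \<open>n j\<close> are
  represented by \<open>{0..<n j}\<close>; \<open>integer_mod_group 0\<close> is the group of all integers, so \<open>n j > 0\<close> has
  to be assumed.
\<close>
definition index_group :: "nat \<Rightarrow> (nat \<Rightarrow> real) \<Rightarrow> nat \<Rightarrow> (nat \<Rightarrow> nat) \<Rightarrow> index monoid" where
  "index_group d c e n =
    product_group {..<d} (\<lambda>i. real_multiples (c i)) \<times>\<times>
    product_group {..<e} (\<lambda>j. integer_mod_group (n j))"

definition index_abs :: "nat \<Rightarrow> nat \<Rightarrow> index \<Rightarrow> real" where
  "index_abs d e g =
    Sup ((\<lambda>i. \<bar>fst g i\<bar>) ` {..<d} \<union> (\<lambda>j. if snd g j = 0 then 0 else 1) ` {..<e})"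

lemma comm_group_index_group: "comm_group (index_group d c e n)"
proof -
  have R: "group (real_multiples x)" for x
  proof (rule groupI)
    show "\<one>\<^bsub>real_multiples x\<^esub> \<in> carrier (real_multiples x)"
      by (auto simp: real_multiples_def intro!: image_eqI[where x = 0])
  next
    fix y z assume "y \<in> carrier (real_multiples x)" "z \<in> carrier (real_multiples x)"
    then obtain k l :: int where "y = x * of_int k" "z = x * of_int l"
      by (auto simp: real_multiples_def)
    then have "y + z = x * of_int (k + l)" by (simp add: distrib_left)
    then show "y \<otimes>\<^bsub>real_multiples x\<^esub> z \<in> carrier (real_multiples x)"
      unfolding real_multiples_def by (simp del: of_int_add) (rule rangeI)
  next
    fix y assume "y \<in> carrier (real_multiples x)"
    then obtain k :: int where "y = x * of_int k" by (auto simp: real_multiples_def)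
    then show "\<exists>z\<in>carrier (real_multiples x). z \<otimes>\<^bsub>real_multiples x\<^esub> y = \<one>\<^bsub>real_multiples x\<^esub>"
      by (intro bexI[where x = "x * of_int (- k)"])
        (simp add: real_multiples_def, unfold real_multiples_def, simp only: partial_object.simps, rule rangeI)
  qed (auto simp: real_multiples_def)
  have "group (index_group d c e n)"
    unfolding index_group_def by (intro DirProd_group) (simp_all add: R)
  then show ?thesis
    by (rule group.group_comm_groupI)
      (auto simp: index_group_def real_multiples_def add.commute)
qed


section \<open>Cubes, density and row decay\<close>

definition cube :: "nat \<Rightarrow> (nat \<Rightarrow> real) \<Rightarrow> nat \<Rightarrow> (nat \<Rightarrow> nat) \<Rightarrow> nat \<Rightarrow> index \<Rightarrow> index set" where
  "cube d c e n N j =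
    {k \<in> carrier (index_group d c e n).
      index_abs d e (k \<otimes>\<^bsub>index_group d c e n\<^esub> inv\<^bsub>index_group d c e n\<^esub> j) \<le> real N / 2}"

definition index_cube :: "nat \<Rightarrow> (nat \<Rightarrow> real) \<Rightarrow> nat \<Rightarrow> (nat \<Rightarrow> nat) \<Rightarrow>
    'i set \<Rightarrow> ('i \<Rightarrow> index) \<Rightarrow> nat \<Rightarrow> index \<Rightarrow> 'i set" where
  "index_cube d c e n I a N j = {i \<in> I. a i \<in> cube d c e n N j}"

text \<open>
  The set \<open>index_cube\<close> may be infinite, so cardinalities are taken in the extended sense, as
  counting measure (\<open>card\<close> would be 0 on infinite sets).
\<close>
definition upper_density :: "nat \<Rightarrow> (nat \<Rightarrow> real) \<Rightarrow> nat \<Rightarrow> (nat \<Rightarrow> nat) \<Rightarrow>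
    'i set \<Rightarrow> ('i \<Rightarrow> index) \<Rightarrow> ennreal" where
  "upper_density d c e n I a =
    limsup (\<lambda>N. SUP j\<in>carrier (index_group d c e n).
      emeasure (count_space UNIV) (index_cube d c e n I a N j) /
      emeasure (count_space UNIV) (cube d c e n N j))"

definition l2_row_decay :: "('h \<Rightarrow> 'h \<Rightarrow> 'k::real_normed_field) \<Rightarrow>
    nat \<Rightarrow> (nat \<Rightarrow> real) \<Rightarrow> nat \<Rightarrow> (nat \<Rightarrow> nat) \<Rightarrow>
    'i set \<Rightarrow> ('i \<Rightarrow> 'h) \<Rightarrow> ('i \<Rightarrow> index) \<Rightarrow> (index \<Rightarrow> 'h) \<Rightarrow> bool" where
  "l2_row_decay ip d c e n I f a E \<longleftrightarrow>
    (\<forall>\<epsilon>>0. \<exists>N>0. \<forall>i\<in>I.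
      (\<Sum>\<^sub>\<infinity>j\<in>carrier (index_group d c e n) - cube d c e n N (a i).
        ennreal ((norm (ip (f i) (E j)))\<^sup>2)) < ennreal \<epsilon>)"

end

theory Submission
  imports Defs
begin

text \<open>
  Row decay says that \<open>f i\<close> lives, up to a small error, on the frame vectors indexed by a cube of
  fixed side \<open>L\<close> around \<open>a i\<close>. The lower frame bound and the lower bound on the norms turn this into
  a fixed amount \<open>\<delta> > 0\<close> of mass \<open>\<Sum>k. \<bar>\<langle>f i, E k\<rangle>\<bar>\<^sup>2\<close> on that cube
  (\<open>row_decay_concentration\<close>).

  Let \<open>S N j\<close> be the cube of side \<open>N\<close> around \<open>j\<close>. If \<open>a i\<close> is in \<open>S N j\<close>, then the mass of \<open>f i\<close> is
  already found on \<open>S (N + L) j\<close>. Now the same mass is counted by columns: the Bessel bound \<open>B\<close> of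
  the \<open>f i\<close>, applied to the vector \<open>E k\<close>, shows that the column of \<open>k\<close> carries at most
  \<open>B * (norm (E k))\<^sup>2 \<le> B * C\<close>. Hence \<open>\<delta>\<close> times the number of such \<open>i\<close> is at most
  \<open>B * C * card (S (N + L) j)\<close> (\<open>card_le_of_concentrated\<close>).

  It remains to compare \<open>S (N + L) j\<close> with \<open>S N j\<close>. Moving each coordinate of a point of the larger
  cube back to the nearest admissible value in the smaller one costs a bounded distance, so the
  larger cube is covered by cubes of one fixed side \<open>M\<close> centred in the smaller one, and these all
  have at most as many points as \<open>S M \<one>\<close>. This bounds the ratio of cardinalities
  uniformly in \<open>N\<close> and \<open>j\<close> (\<open>card_cube_add_le\<close>), for every \<open>N\<close> and not only in the limit.
\<close>

section \<open>Bessel sequences in a Hilbert space\<close>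

lemma sum_le_infsum_ennreal:
  fixes g :: "'a \<Rightarrow> ennreal"
  assumes "finite F" "F \<subseteq> A"
  shows "sum g F \<le> infsum g A"
proof -
  have "infsum g A = (SUP F\<in>{F. finite F \<and> F \<subseteq> A}. sum g F)"
    by (rule nonneg_infsum_complete) simp
  then show ?thesis
    using assms by (auto intro: SUP_upper)
qed

lemma norm_conjugation: "norm (conjugation a) = norm (a :: 'k::hilbert_scalar)"
proof (cases "a = 0")
  case True
  have "conjugation (0::'k) + conjugation 0 = conjugation 0"
    by (simp flip: conjugation_add)
  with True show ?thesis by simp
next
  case False
  have "norm (conjugation a) * norm a = norm a * norm a"
    using arg_cong[OF conjugation_mult_self[of a], of norm]
    by (simp add: norm_mult power2_eq_square)
  with False show ?thesis by simp
qed

lemma (in hilbert_space) norm_ip_commute: "norm (ip y x) = norm (ip x y)"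
  using ip_commute[of y x] by (simp add: norm_conjugation)

lemma frame_imp_bessel_sequence: "frame ip J E \<Longrightarrow> bessel_sequence ip J E"
  unfolding frame_def bessel_sequence_def by blast

text \<open>
  Testing the Bessel inequality on \<open>E j\<close> itself and keeping only the diagonal term gives
  \<open>(norm (E j)) ^ 4 \<le> C * (norm (E j))\<^sup>2\<close>.
\<close>
lemma (in hilbert_space) bessel_sequence_norm_bounded:
  assumes "bessel_sequence ip J E"
  obtains C where "C > 0" "\<And>j. j \<in> J \<Longrightarrow> (norm (E j))\<^sup>2 \<le> C"
proof -
  obtain C where C: "C > 0"
    "\<And>x. (\<Sum>\<^sub>\<infinity>i\<in>J. ennreal ((norm (ip x (E i)))\<^sup>2)) \<le> ennreal (C * (norm x)\<^sup>2)"
    using assms unfolding bessel_sequence_def by blast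
  have "(norm (E j))\<^sup>2 \<le> C" if "j \<in> J" for j
  proof -
    have "(\<Sum>i\<in>{j}. ennreal ((norm (ip (E j) (E i)))\<^sup>2)) \<le> ennreal (C * (norm (E j))\<^sup>2)"
      by (rule order_trans[OF sum_le_infsum_ennreal C(2)]) (use that in auto)
    then have "(norm (ip (E j) (E j)))\<^sup>2 \<le> C * (norm (E j))\<^sup>2"
      using C(1) by simp
    then have "(norm (E j))\<^sup>2 * (norm (E j))\<^sup>2 \<le> C * (norm (E j))\<^sup>2"
      by (simp add: ip_self norm_power flip: power2_eq_square)
    then show ?thesis
      using C(1) mult_right_le_imp_le[of "(norm (E j))\<^sup>2" "(norm (E j))\<^sup>2" C]
      by (cases "E j = 0") auto
  qed
  with C(1) that show thesis by blast
qed

text \<open>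
  Double counting in the matrix with entries \<open>(norm (ip (f i) (E k)))\<^sup>2\<close>: each row in \<open>F\<close> has
  mass at least \<open>\<delta>\<close> on \<open>S\<close>, while the Bessel property limits the mass of each column.
\<close>
lemma (in hilbert_space) card_le_of_concentrated:
  assumes bessel: "\<And>x. (\<Sum>\<^sub>\<infinity>i\<in>I. ennreal ((norm (ip x (f i)))\<^sup>2)) \<le> ennreal (B * (norm x)\<^sup>2)"
    and "B \<ge> 0"
    and F: "finite F" "F \<subseteq> I"
    and E: "\<And>k. k \<in> S \<Longrightarrow> (norm (E k))\<^sup>2 \<le> C"
    and conc: "\<And>i. i \<in> F \<Longrightarrow> \<delta> \<le> (\<Sum>k\<in>S. (norm (ip (f i) (E k)))\<^sup>2)"
  shows "\<delta> * real (card F) \<le> B * C * real (card S)"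
proof -
  have col: "(\<Sum>i\<in>F. (norm (ip (f i) (E k)))\<^sup>2) \<le> B * C" if "k \<in> S" for k
  proof -
    have "(\<Sum>i\<in>F. ennreal ((norm (ip (E k) (f i)))\<^sup>2)) \<le> ennreal (B * (norm (E k))\<^sup>2)"
      by (rule order_trans[OF sum_le_infsum_ennreal bessel]) (use F in auto)
    then have "(\<Sum>i\<in>F. (norm (ip (E k) (f i)))\<^sup>2) \<le> B * (norm (E k))\<^sup>2"
      using \<open>B \<ge> 0\<close> by (simp add: sum_ennreal)
    also have "\<dots> \<le> B * C"
      using E[OF that] \<open>B \<ge> 0\<close> by (rule mult_left_mono)
    finally show ?thesis
      by (simp add: norm_ip_commute[of "E k"])
  qed
  have "\<delta> * real (card F) = (\<Sum>i\<in>F. \<delta>)"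
    by simp
  also have "\<dots> \<le> (\<Sum>i\<in>F. \<Sum>k\<in>S. (norm (ip (f i) (E k)))\<^sup>2)"
    by (rule sum_mono) (rule conc)
  also have "\<dots> = (\<Sum>k\<in>S. \<Sum>i\<in>F. (norm (ip (f i) (E k)))\<^sup>2)"
    by (rule sum.swap)
  also have "\<dots> \<le> (\<Sum>k\<in>S. B * C)"
    by (rule sum_mono) (rule col)
  finally show ?thesis
    by (simp add: mult.commute)
qed


section \<open>Cubes in the index group\<close>

lemma group_real_multiples: "group (real_multiples x)"
proof (rule groupI)
  fix y z assume "y \<in> carrier (real_multiples x)" "z \<in> carrier (real_multiples x)"
  then obtain k l :: int where "y = x * of_int k" "z = x * of_int l"
    by (auto simp: real_multiples_def)
  then have "y + z = x * of_int (k + l)" by (simp add: distrib_left)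
  then show "y \<otimes>\<^bsub>real_multiples x\<^esub> z \<in> carrier (real_multiples x)"
    unfolding real_multiples_def by (simp del: of_int_add) (rule rangeI)
next
  fix y assume "y \<in> carrier (real_multiples x)"
  then obtain k :: int where "y = x * of_int k" by (auto simp: real_multiples_def)
  then have "- y = x * of_int (- k)" by simp
  then have "- y \<in> carrier (real_multiples x)"
    unfolding real_multiples_def partial_object.simps by (rule range_eqI)
  then show "\<exists>z\<in>carrier (real_multiples x). z \<otimes>\<^bsub>real_multiples x\<^esub> y = \<one>\<^bsub>real_multiples x\<^esub>"
    by (intro bexI[where x = "- y"]) (simp_all add: real_multiples_def)
qed (auto simp: real_multiples_def intro!: image_eqI[where x = 0])

lemma inv_real_multiples:
  assumes "y \<in> carrier (real_multiples x)"
  shows "inv\<^bsub>real_multiples x\<^esub> y = - y"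
proof (rule group.inv_equality[OF group_real_multiples _ assms])
  obtain k :: int where "y = x * of_int k" using assms by (auto simp: real_multiples_def)
  then have "- y = x * of_int (- k)" by simp
  then show "- y \<in> carrier (real_multiples x)"
    unfolding real_multiples_def partial_object.simps by (rule range_eqI)
qed (simp add: real_multiples_def)

locale index_parameters =
  fixes d e :: nat and c :: "nat \<Rightarrow> real" and n :: "nat \<Rightarrow> nat"
  assumes rank_pos: "d \<ge> 1"
    and generator_pos: "i < d \<Longrightarrow> c i > 0"
    and modulus_pos: "j < e \<Longrightarrow> n j > 0"
begin

abbreviation "G \<equiv> index_group d c e n"
abbreviation "S \<equiv> cube d c e n"

sublocale comm_group G
  by (rule comm_group_index_group)

lemma carrier_index_group:
  "carrier G = (\<Pi>\<^sub>E i\<in>{..<d}. range (\<lambda>k::int. c i * of_int k)) \<times> (\<Pi>\<^sub>E j\<in>{..<e}. {0..<int (n j)})"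
proof -
  have "(\<Pi>\<^sub>E j\<in>{..<e}. carrier (integer_mod_group (n j))) = (\<Pi>\<^sub>E j\<in>{..<e}. {0..<int (n j)})"
    by (rule PiE_cong) (use modulus_pos in \<open>fastforce simp: carrier_integer_mod_group\<close>)
  then show ?thesis
    by (simp add: index_group_def real_multiples_def)
qed

lemma carrier_coordinate_multiple:
  assumes "k \<in> carrier G" "i < d"
  obtains t :: int where "fst k i = c i * of_int t"
proof -
  have "fst k i \<in> range (\<lambda>t::int. c i * of_int t)"
    using assms by (auto simp: carrier_index_group mem_Times_iff PiE_iff)
  then show thesis using that by blast
qed

text \<open>
  Residues are represented in \<open>{0..<n i}\<close>, so two of them are equal as soon as their difference
  vanishes modulo \<open>n i\<close>; this reduces the group operations to coordinates. The supremum is over a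
  set of nonnegative numbers that is nonempty because \<open>d \<ge> 1\<close>.
\<close>
lemma index_abs_difference_le_iff:
  assumes k: "k \<in> carrier G" and j: "j \<in> carrier G"
  shows "index_abs d e (k \<otimes>\<^bsub>G\<^esub> inv\<^bsub>G\<^esub> j) \<le> r \<longleftrightarrow>
    (\<forall>i<d. \<bar>fst k i - fst j i\<bar> \<le> r) \<and> (\<forall>i<e. snd k i = snd j i \<or> 1 \<le> r)"
proof -
  obtain k1 k2 j1 j2 where kj: "k = (k1, k2)" "j = (j1, j2)"
    by (cases k, cases j)
  have j1: "j1 \<in> (\<Pi>\<^sub>E i\<in>{..<d}. carrier (real_multiples (c i)))"
    and j2: "j2 \<in> (\<Pi>\<^sub>E i\<in>{..<e}. carrier (integer_mod_group (n i)))"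
    using j kj by (auto simp: index_group_def)
  have "inv\<^bsub>G\<^esub> j =
      (\<lambda>i\<in>{..<d}. - j1 i, \<lambda>i\<in>{..<e}. (- j2 i) mod int (n i))"
    using j1 j2 unfolding index_group_def kj
    by (subst inv_DirProd)
      (auto simp: group_real_multiples inv_real_multiples PiE_iff intro!: restrict_ext)
  then have diff: "k \<otimes>\<^bsub>G\<^esub> inv\<^bsub>G\<^esub> j =
      (\<lambda>i\<in>{..<d}. k1 i - j1 i, \<lambda>i\<in>{..<e}. (k2 i - j2 i) mod int (n i))"
    by (auto simp: kj index_group_def real_multiples_def mod_add_right_eq intro!: restrict_ext)
  have res: "(k2 i - j2 i) mod int (n i) = 0 \<longleftrightarrow> k2 i = j2 i" if "i < e" for i
  proof -
    have "k2 i \<in> {0..<int (n i)}" "j2 i \<in> {0..<int (n i)}"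
      using k j that by (auto simp: carrier_index_group kj PiE_iff)
    then show ?thesis
      by (metis atLeastLessThan_iff mod_eq_dvd_iff mod_pos_pos_trivial dvd_eq_mod_eq_0)
  qed
  let ?T = "(\<lambda>i. \<bar>k1 i - j1 i\<bar>) ` {..<d} \<union> (\<lambda>i. if k2 i = j2 i then 0 else 1) ` {..<e}"
  have "index_abs d e (k \<otimes>\<^bsub>G\<^esub> inv\<^bsub>G\<^esub> j) = Sup ?T"
    unfolding index_abs_def diff by (intro arg_cong[where f = Sup] arg_cong2[where f = "(\<union>)"] image_cong)
      (auto simp: res)
  moreover have "Sup ?T \<le> r \<longleftrightarrow> (\<forall>t\<in>?T. t \<le> r)"
    by (rule cSup_le_iff) (use rank_pos in \<open>auto simp: lessThan_empty_iff\<close>)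
  moreover have "0 \<le> r" if "\<forall>i<d. \<bar>k1 i - j1 i\<bar> \<le> r"
  proof -
    have "\<bar>k1 0 - j1 0\<bar> \<le> r" using that rank_pos by simp
    then show ?thesis by linarith
  qed
  ultimately show ?thesis
    by (auto simp: kj)
qed

lemma mem_cube_iff:
  assumes "j \<in> carrier G"
  shows "k \<in> S N j \<longleftrightarrow> k \<in> carrier G \<and>
    (\<forall>i<d. \<bar>fst k i - fst j i\<bar> \<le> real N / 2) \<and> (\<forall>i<e. snd k i = snd j i \<or> 2 \<le> N)"
  using assms index_abs_difference_le_iff[OF _ assms, of k "real N / 2"] by (auto simp: cube_def)

lemma cube_subset_carrier: "S N j \<subseteq> carrier G"
  by (auto simp: cube_def)

lemma centre_mem_cube: "j \<in> carrier G \<Longrightarrow> j \<in> S N j"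
  by (simp add: mem_cube_iff)

text \<open>
  The triangle inequality. A residue of \<open>k\<close> that differs from that of \<open>j\<close> must change on the way
  from \<open>j\<close> to \<open>l\<close> or from \<open>l\<close> to \<open>k\<close>, which needs side at least 2 in that step.
\<close>
lemma cube_subset_cube_add:
  assumes "j \<in> carrier G" "l \<in> S N j"
  shows "S M l \<subseteq> S (N + M) j"
proof
  fix k assume k: "k \<in> S M l"
  have l: "l \<in> carrier G" using assms(2) cube_subset_carrier by blast
  have "\<bar>fst k i - fst j i\<bar> \<le> real (N + M) / 2" if "i < d" for i
  proof -
    have "\<bar>fst k i - fst l i\<bar> \<le> real M / 2" "\<bar>fst l i - fst j i\<bar> \<le> real N / 2"
      using k assms l that by (auto simp: mem_cube_iff)
    then show ?thesis
      using abs_triangle_ineq[of "fst k i - fst l i" "fst l i - fst j i"] by simp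
  qed
  moreover have "snd k i = snd j i \<or> 2 \<le> N + M" if "i < e" for i
    using k assms l that by (fastforce simp: mem_cube_iff)
  ultimately show "k \<in> S (N + M) j"
    using k assms(1) l by (simp add: mem_cube_iff)
qed

lemma finite_cube:
  assumes "j \<in> carrier G"
  shows "finite (S N j)"
proof (rule finite_subset)
  let ?Z = "\<lambda>i. {\<lfloor>(fst j i - real N / 2) / c i\<rfloor>..\<lceil>(fst j i + real N / 2) / c i\<rceil>}"
  show "S N j \<subseteq>
    (\<Pi>\<^sub>E i\<in>{..<d}. (\<lambda>k. c i * of_int k) ` ?Z i) \<times> (\<Pi>\<^sub>E i\<in>{..<e}. {0..<int (n i)})"
  proof
    fix k assume k: "k \<in> S N j"
    have "fst k i \<in> (\<lambda>k. c i * of_int k) ` ?Z i" if "i < d" for i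
    proof -
      obtain t :: int where t: "fst k i = c i * of_int t"
        using carrier_coordinate_multiple[OF subsetD[OF cube_subset_carrier k] \<open>i < d\<close>] .
      have "\<bar>c i * of_int t - fst j i\<bar> \<le> real N / 2"
        using k assms that t by (auto simp: mem_cube_iff)
      then have "c i * of_int t - fst j i \<le> real N / 2" "fst j i - c i * of_int t \<le> real N / 2"
        by (simp_all only: abs_le_iff minus_diff_eq)
      then have "(fst j i - real N / 2) / c i \<le> of_int t" "of_int t \<le> (fst j i + real N / 2) / c i"
        using generator_pos[OF that] by (simp_all add: field_simps)
      then have "t \<in> ?Z i"
        by (simp add: floor_le_iff le_ceiling_iff)
      with t show ?thesis by blast
    qed
    then show "k \<in> (\<Pi>\<^sub>E i\<in>{..<d}. (\<lambda>k. c i * of_int k) ` ?Z i) \<times> (\<Pi>\<^sub>E i\<in>{..<e}. {0..<int (n i)})"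
      using k assms by (auto simp: mem_cube_iff carrier_index_group PiE_iff mem_Times_iff)
  qed
  show "finite ((\<Pi>\<^sub>E i\<in>{..<d}. (\<lambda>k. c i * of_int k) ` ?Z i) \<times> (\<Pi>\<^sub>E i\<in>{..<e}. {0..<int (n i)}))"
    by (intro finite_cartesian_product finite_PiE) auto
qed

text \<open>Translation by the inverse of \<open>l\<close> embeds the one cube into the other.\<close>
lemma card_cube_le_card_cube_one:
  assumes l: "l \<in> carrier G"
  shows "card (S M l) \<le> card (S M \<one>\<^bsub>G\<^esub>)"
proof (rule card_inj_on_le)
  show "inj_on (\<lambda>k. k \<otimes>\<^bsub>G\<^esub> inv\<^bsub>G\<^esub> l) (S M l)"
    by (rule inj_on_subset[OF inj_on_multc[OF inv_closed[OF l]] cube_subset_carrier])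
  show "(\<lambda>k. k \<otimes>\<^bsub>G\<^esub> inv\<^bsub>G\<^esub> l) ` S M l \<subseteq> S M \<one>\<^bsub>G\<^esub>"
    using l by (auto simp: cube_def)
qed (simp add: finite_cube)

text \<open>
  The nearest point to \<open>x * t\<close> among the multiples of \<open>x\<close> in \<open>[-r, r]\<close>. The largest of those
  multiples falls short of \<open>r\<close> by less than \<open>x\<close>, whence the extra summand \<open>x\<close>.
\<close>
lemma clamp_multiple:
  fixes t :: int and x r s :: real
  assumes "x > 0" "r \<ge> 0" "s \<ge> 0" and "\<bar>x * of_int t\<bar> \<le> r + s"
  obtains u :: int where "\<bar>x * of_int u\<bar> \<le> r" "\<bar>x * of_int t - x * of_int u\<bar> \<le> s + x"
proof -
  define T where "T = \<lfloor>r / x\<rfloor>"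
  have T: "0 \<le> T" using assms by (simp add: T_def)
  have "real_of_int T \<le> r / x" "r / x < real_of_int T + 1"
    unfolding T_def by linarith+
  then have Tx: "x * real_of_int T \<le> r" "r < x * real_of_int T + x"
    using assms(1) by (simp_all add: field_simps)
  have Tx0: "0 \<le> x * real_of_int T" using T assms(1) by simp
  consider "\<bar>t\<bar> \<le> T" | "t > T" | "t < - T" by linarith
  then show thesis
  proof cases
    case 1
    have "\<bar>x * of_int t\<bar> = x * real_of_int \<bar>t\<bar>" using assms(1) by (simp add: abs_mult)
    also have "\<dots> \<le> x * real_of_int T" using 1 assms(1) by (intro mult_left_mono) linarith+
    finally show thesis using that[of t] Tx assms by simp
  next
    case 2
    then have "x * real_of_int T \<le> x * of_int t" using assms(1) by simp
    then show thesis using that[of T] Tx Tx0 assms(4) by (simp add: abs_le_iff)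
  next
    case 3
    then have "x * of_int t \<le> x * real_of_int (- T)"
      using assms(1) by (intro mult_left_mono) linarith+
    then show thesis using that[of "- T"] Tx Tx0 assms(4) by (simp add: abs_le_iff)
  qed
qed

text \<open>
  The centre of a small cube containing \<open>k\<close> keeps the residues of \<open>j\<close> and has the real coordinates
  of \<open>k\<close> clamped towards \<open>j\<close>. Side \<open>M \<ge> 2\<close> lets the residues of \<open>k\<close> be arbitrary.
\<close>
lemma cube_add_covered:
  assumes j: "j \<in> carrier G"
    and M: "2 \<le> M" "\<And>i. i < d \<Longrightarrow> real L / 2 + c i \<le> real M / 2"
  shows "S (N + L) j \<subseteq> (\<Union>l\<in>S N j. S M l)"
proof
  fix k assume k: "k \<in> S (N + L) j"
  have "\<exists>y\<in>range (\<lambda>u::int. c i * of_int u).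
      \<bar>y - fst j i\<bar> \<le> real N / 2 \<and> \<bar>fst k i - y\<bar> \<le> real M / 2" if i: "i < d" for i
  proof -
    obtain s t :: int where st: "fst k i = c i * of_int s" "fst j i = c i * of_int t"
      by (metis carrier_coordinate_multiple[OF subsetD[OF cube_subset_carrier k] i]
          carrier_coordinate_multiple[OF j i])
    have "\<bar>fst k i - fst j i\<bar> \<le> real N / 2 + real L / 2"
      using k j i by (auto simp: mem_cube_iff add_divide_distrib)
    then have "\<bar>c i * of_int (s - t)\<bar> \<le> real N / 2 + real L / 2"
      by (simp add: st right_diff_distrib)
    then obtain u :: int where u: "\<bar>c i * of_int u\<bar> \<le> real N / 2"
      "\<bar>c i * of_int (s - t) - c i * of_int u\<bar> \<le> real L / 2 + c i"
      using clamp_multiple[OF generator_pos[OF i], of "real N / 2" "real L / 2" "s - t"] by auto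
    show ?thesis
      by (rule bexI[OF _ rangeI, of _ _ "t + u"]) (use u M(2)[OF i] in \<open>simp add: st algebra_simps\<close>)
  qed
  then obtain y where y: "\<And>i. i < d \<Longrightarrow> y i \<in> range (\<lambda>u::int. c i * of_int u) \<and>
      \<bar>y i - fst j i\<bar> \<le> real N / 2 \<and> \<bar>fst k i - y i\<bar> \<le> real M / 2"
    by metis
  define l where "l = (restrict y {..<d}, snd j)"
  have "l \<in> carrier G"
    using y j by (auto simp: l_def carrier_index_group)
  moreover from this have "l \<in> S N j"
    using y j by (auto simp: mem_cube_iff l_def)
  ultimately show "k \<in> (\<Union>l\<in>S N j. S M l)"
    using y k j M(1) by (intro UN_I[of l]) (auto simp: mem_cube_iff l_def)
qed

lemma card_cube_add_le:
  obtains K where "\<And>N j. j \<in> carrier G \<Longrightarrow> card (S (N + L) j) \<le> K * card (S N j)"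
proof -
  \<comment> \<open>A sum instead of a maximum, as an integer bound for all the \<open>2 * c i\<close> at once.\<close>
  define M where "M = 2 + L + (\<Sum>i<d. nat \<lceil>2 * c i\<rceil>)"
  have M: "real L / 2 + c i \<le> real M / 2" if "i < d" for i
  proof -
    have "nat \<lceil>2 * c i\<rceil> \<le> (\<Sum>i<d. nat \<lceil>2 * c i\<rceil>)"
      by (rule member_le_sum) (use that in auto)
    then have "real (L + nat \<lceil>2 * c i\<rceil>) \<le> real M"
      unfolding of_nat_le_iff M_def by simp
    then show ?thesis
      using real_nat_ceiling_ge[of "2 * c i"] by simp
  qed
  have "card (S (N + L) j) \<le> card (S M \<one>\<^bsub>G\<^esub>) * card (S N j)" if j: "j \<in> carrier G" for N j
  proof -
    have "card (S (N + L) j) \<le> card (\<Union>l\<in>S N j. S M l)"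
    proof (rule card_mono)
      show "finite (\<Union>l\<in>S N j. S M l)"
        using finite_cube j cube_subset_carrier by blast
      show "S (N + L) j \<subseteq> (\<Union>l\<in>S N j. S M l)"
        by (rule cube_add_covered[OF j _ M]) (simp_all add: M_def)
    qed
    also have "\<dots> \<le> (\<Sum>l\<in>S N j. card (S M l))"
      by (rule card_UN_le) (rule finite_cube[OF j])
    also have "\<dots> \<le> (\<Sum>l\<in>S N j. card (S M \<one>\<^bsub>G\<^esub>))"
      using cube_subset_carrier by (intro sum_mono card_cube_le_card_cube_one) blast
    finally show ?thesis by (simp add: mult.commute)
  qed
  then show thesis by (rule that)
qed

end


section \<open>Row decay and density\<close>

text \<open>
  If the norms are at least \<open>m\<close> and \<open>A\<close> is the lower frame bound, every row has total mass at least
  \<open>A * m\<^sup>2\<close>; row decay with tolerance \<open>\<delta> = A * m\<^sup>2 / 2\<close> leaves at least \<open>\<delta>\<close> on a cube.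
\<close>
lemma (in index_parameters) row_decay_concentration:
  assumes frame: "frame ip (carrier G) E"
    and low: "(INF i\<in>I. ennreal (norm (f i))) > 0"
    and a: "a \<in> I \<rightarrow> carrier G"
    and decay: "l2_row_decay ip d c e n I f a E"
  obtains L \<delta> where "\<delta> > 0"
    "\<And>i. i \<in> I \<Longrightarrow> \<delta> \<le> (\<Sum>k\<in>S L (a i). (norm (ip (f i) (E k)))\<^sup>2)"
proof -
  obtain A where A: "A > 0"
    "\<And>x. ennreal (A * (norm x)\<^sup>2) \<le> (\<Sum>\<^sub>\<infinity>k\<in>carrier G. ennreal ((norm (ip x (E k)))\<^sup>2))"
    using frame unfolding frame_def by blast
  \<comment> \<open>The infimum is infinite when \<open>I\<close> is empty, so a real number strictly below it is used.\<close>
  obtain m where m: "m > 0" "ennreal m < (INF i\<in>I. ennreal (norm (f i)))"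
    using ennreal_rat_dense[OF low] by (metis ennreal_less_zero_iff)
  define \<delta> where "\<delta> = A * m\<^sup>2 / 2"
  have \<delta>: "\<delta> > 0" using A m by (simp add: \<delta>_def)
  obtain L where L: "\<And>i. i \<in> I \<Longrightarrow>
      (\<Sum>\<^sub>\<infinity>k\<in>carrier G - S L (a i). ennreal ((norm (ip (f i) (E k)))\<^sup>2)) < ennreal \<delta>"
    using decay \<delta> unfolding l2_row_decay_def by blast
  have "\<delta> \<le> (\<Sum>k\<in>S L (a i). (norm (ip (f i) (E k)))\<^sup>2)" if i: "i \<in> I" for i
  proof -
    let ?g = "\<lambda>k. (norm (ip (f i) (E k)))\<^sup>2"
    have fin: "finite (S L (a i))"
      using a i by (intro finite_cube) auto
    have "ennreal m \<le> ennreal (norm (f i))"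
      using m(2) i by (meson INF_lower less_imp_le order_trans)
    then have "A * m\<^sup>2 \<le> A * (norm (f i))\<^sup>2"
      using m A by (simp add: power_mono)
    then have "ennreal (2 * \<delta>) \<le> ennreal (A * (norm (f i))\<^sup>2)"
      by (simp add: \<delta>_def ennreal_leI)
    also have "\<dots> \<le> (\<Sum>\<^sub>\<infinity>k\<in>carrier G. ennreal (?g k))"
      by (rule A(2))
    also have "\<dots> = (\<Sum>\<^sub>\<infinity>k\<in>S L (a i) \<union> (carrier G - S L (a i)). ennreal (?g k))"
      using cube_subset_carrier[of L "a i"] by (simp add: Un_absorb1)
    also have "\<dots> = (\<Sum>k\<in>S L (a i). ennreal (?g k)) + (\<Sum>\<^sub>\<infinity>k\<in>carrier G - S L (a i). ennreal (?g k))"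
      using fin by (subst infsum_Un_disjoint) (auto intro: nonneg_summable_on_complete)
    also have "\<dots> \<le> ennreal (\<Sum>k\<in>S L (a i). ?g k) + ennreal \<delta>"
      using L[OF i] by (intro add_mono) (auto simp: sum_ennreal)
    also have "\<dots> = ennreal ((\<Sum>k\<in>S L (a i). ?g k) + \<delta>)"
      using \<delta> by (simp add: sum_nonneg)
    finally have "2 * \<delta> \<le> (\<Sum>k\<in>S L (a i). ?g k) + \<delta>"
      using \<delta> by (subst (asm) ennreal_le_iff) (simp_all add: sum_nonneg add_nonneg_pos less_imp_le)
    then show ?thesis by simp
  qed
  with \<delta> show thesis by (rule that)
qed

text \<open>
  Bounding only finite subsets \<open>F\<close> is enough: a set whose finite subsets have bounded cardinality is
  itself finite. The centre of a cube belongs to it, so no quotient has denominator 0.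
\<close>
lemma (in index_parameters) upper_density_finite:
  assumes bound: "\<And>N j F. j \<in> carrier G \<Longrightarrow> finite F \<Longrightarrow> F \<subseteq> index_cube d c e n I a N j \<Longrightarrow>
      real (card F) \<le> K * real (card (S N j))"
  shows "upper_density d c e n I a < \<infinity>"
proof -
  have ratio: "emeasure (count_space UNIV) (index_cube d c e n I a N j) /
      emeasure (count_space UNIV) (S N j) \<le> ennreal K" if j: "j \<in> carrier G" for N j
  proof -
    let ?X = "index_cube d c e n I a N j"
    have pos: "0 < real (card (S N j))"
      using finite_cube[OF j] centre_mem_cube[OF j] by (auto simp: card_gt_0_iff)
    have "finite ?X \<and> card ?X \<le> nat \<lfloor>K * real (card (S N j))\<rfloor>"
      by (rule finite_if_finite_subsets_card_bdd) (use bound[OF j] in \<open>simp add: le_nat_floor\<close>)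
    then have X: "finite ?X" by simp
    have "emeasure (count_space UNIV) ?X / emeasure (count_space UNIV) (S N j) =
        ennreal (real (card ?X) / real (card (S N j)))"
      using X finite_cube[OF j] pos
      by (simp add: emeasure_count_space_finite ennreal_of_nat_eq_real_of_nat divide_ennreal)
    also have "\<dots> \<le> ennreal K"
      using bound[OF j X] pos by (intro ennreal_leI) (simp add: divide_le_eq)
    finally show ?thesis .
  qed
  have "upper_density d c e n I a \<le> ennreal K"
    unfolding upper_density_def
    by (intro Limsup_bounded always_eventually allI SUP_least ratio)
  then show ?thesis
    by (simp add: le_less_trans)
qed

theorem theorem3p3:
  fixes scl :: "'k::hilbert_scalar \<Rightarrow> 'h::banach \<Rightarrow> 'h"
    and ip :: "'h \<Rightarrow> 'h \<Rightarrow> 'k"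
    and d e :: nat and c :: "nat \<Rightarrow> real" and n :: "nat \<Rightarrow> nat"
    and I :: "'i set" and f :: "'i \<Rightarrow> 'h" and a :: "'i \<Rightarrow> index" and E :: "index \<Rightarrow> 'h"
  assumes "hilbert_space scl ip"
    and "separable_space (euclidean :: 'h topology)"
    and "d \<ge> 1" and "\<And>i. i < d \<Longrightarrow> c i > 0" and "\<And>j. j < e \<Longrightarrow> n j > 0"
    and "countable I"
    and "bessel_sequence ip I f"
    and "(INF i\<in>I. ennreal (norm (f i))) > 0"
    and "frame ip (carrier (index_group d c e n)) E"
    and "a \<in> I \<rightarrow> carrier (index_group d c e n)"
    and "l2_row_decay ip d c e n I f a E"
  shows "upper_density d c e n I a < \<infinity>"
proof -
  interpret hilbert_space scl ip by fact
  interpret index_parameters d e c n by unfold_locales fact+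
  obtain B where B: "B > 0"
    "\<And>x. (\<Sum>\<^sub>\<infinity>i\<in>I. ennreal ((norm (ip x (f i)))\<^sup>2)) \<le> ennreal (B * (norm x)\<^sup>2)"
    using assms(7) unfolding bessel_sequence_def by blast
  obtain C where C: "C > 0" "\<And>k. k \<in> carrier G \<Longrightarrow> (norm (E k))\<^sup>2 \<le> C"
    using bessel_sequence_norm_bounded[OF frame_imp_bessel_sequence[OF assms(9)]] by blast
  obtain L \<delta> where \<delta>: "\<delta> > 0"
    "\<And>i. i \<in> I \<Longrightarrow> \<delta> \<le> (\<Sum>k\<in>S L (a i). (norm (ip (f i) (E k)))\<^sup>2)"
    using row_decay_concentration[OF assms(9,8,10,11)] by blast
  obtain K where K: "\<And>N j. j \<in> carrier G \<Longrightarrow> card (S (N + L) j) \<le> K * card (S N j)"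
    using card_cube_add_le[of L] by blast
  show ?thesis
  proof (rule upper_density_finite)
    fix N j F
    assume j: "j \<in> carrier G" and F: "finite F" "F \<subseteq> index_cube d c e n I a N j"
    have "\<delta> * real (card F) \<le> B * C * real (card (S (N + L) j))"
    proof (rule card_le_of_concentrated[OF B(2) _ F(1)])
      show "F \<subseteq> I" using F(2) by (auto simp: index_cube_def)
      show "(norm (E k))\<^sup>2 \<le> C" if "k \<in> S (N + L) j" for k
        using that C(2) cube_subset_carrier by blast
      show "\<delta> \<le> (\<Sum>k\<in>S (N + L) j. (norm (ip (f i) (E k)))\<^sup>2)" if "i \<in> F" for i
      proof -
        have i: "i \<in> I" "a i \<in> S N j" using that F(2) by (auto simp: index_cube_def)
        have "\<delta> \<le> (\<Sum>k\<in>S L (a i). (norm (ip (f i) (E k)))\<^sup>2)"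
          by (rule \<delta>(2)[OF i(1)])
        also have "\<dots> \<le> (\<Sum>k\<in>S (N + L) j. (norm (ip (f i) (E k)))\<^sup>2)"
          by (rule sum_mono2[OF finite_cube[OF j] cube_subset_cube_add[OF j i(2)]]) simp
        finally show ?thesis .
      qed
    qed (use B in simp)
    also have "\<dots> \<le> B * C * real (K * card (S N j))"
      using K[OF j] B C by (intro mult_left_mono) (simp_all del: of_nat_mult)
    finally show "real (card F) \<le> B * C * real K / \<delta> * real (card (S N j))"
      using \<delta>(1) by (simp add: field_simps)
  qed
qed

end
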